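(* Let $0<a<1$ and $0\le b<1$. If the dynamical system $f_\pm$ has a rational rotation number, then $f_\pm$ has a universal limit cycle $C$. Thus every orbit of $f_\pm$ converges to $C$. Furthermore, the symbolic sequence of every orbit is eventually periodic.
   Context: For real $x$ let $\{x\}:=x-\lfloor x\rfloor\in[0,1)$ and $\{x\}_+:=1-\{-x\}\in(0,1]$. For constants $0<a<1$, $0\le b<1$ define $f_-,f_+:[0,1]\to[0,1]$ by $f_-(x)=\{ax+b\}$, $f_+(x)=\{ax+b\}_+$, and let $f_\pm$ be the multi-valued map $x\mapsto\{f_-(x),f_+(x)\}$. An orbit of $x\in[0,1]$ under $f_\pm$ is any sequence $(x_n)_{n\ge0}$ with $x_0=x$ and $x_{n+1}\in f_\pm(x_n)$ for all $n\ge0$. A periodic orbit is an orbit with $x_{n+q}=x_n$ for some $q\ge1$ and all $n\ge0$; it is then written $\{x_0,\dots,x_{q-1}\}$. An orbit $(x_n)$ converges to a periodic orbit $C=\{y_0,\dots,y_{k-1}\}$ if there exists $j$ such that $x_n-y_{(j+n)\bmod k}\to0$ as $n\to\infty$. $C$ is a universal limit cycle if every orbit, with any initial point in $[0,1]$, converges to $C$. The symbolic sequence of an orbit $(x_i)_{i\ge0}$ is the integer sequence $(\varepsilon_i)_{i\ge0}$ given by $\varepsilon_i:=ax_i+b-x_{i+1}$. (If $a+b\ge1$, then $\varepsilon_i\in\{0,1\}$.) Rotation number: let $F_-(x):=ax+b+(1-a)\lfloor x\rfloor$ and $F_+(x):=ax+b-(1-a)\lfloor 1-x\rfloor$ for $x\in\mathbb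 R$. The rotation number $\rho\in[0,1)$ of $f_\pm$ is the number such that $F_-^n(x)/n\to\rho$ and $F_+^n(x)/n\to\rho$ as $n\to\infty$ for every $x\in\mathbb R$ (the limits exist, coincide and do not depend on $x$). *)

theory Defs
  imports Complex_Main
begin

definition frac_plus :: "real \<Rightarrow> real" where
  "frac_plus x = 1 - frac (- x)"

definition f_minus :: "real \<Rightarrow> real \<Rightarrow> real \<Rightarrow> real" where
  "f_minus a b x = frac (a * x + b)"

definition f_plus :: "real \<Rightarrow> real \<Rightarrow> real \<Rightarrow> real" where
  "f_plus a b x = frac_plus (a * x + b)"

definition f_pm :: "real \<Rightarrow> real \<Rightarrow> real \<Rightarrow> real set" where
  "f_pm a b x = {f_minus a b x, f_plus a b x}"

text \<open>Only the initial point has to be required to lie in \<open>[0,1]\<close>: both branches take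
  values in \<open>[0,1]\<close> (lemma \<open>is_orbit_in_unit\<close> below).\<close>

definition is_orbit :: "real \<Rightarrow> real \<Rightarrow> (nat \<Rightarrow> real) \<Rightarrow> bool" where
  "is_orbit a b x \<longleftrightarrow> x 0 \<in> {0..1} \<and> (\<forall>n. x (Suc n) \<in> f_pm a b (x n))"

text \<open>A periodic orbit \<open>{y 0, \<dots>, y (q - 1)}\<close> is represented by the sequence \<open>y\<close> together
  with a (not necessarily minimal) period \<open>q\<close>.\<close>

definition is_periodic_orbit :: "real \<Rightarrow> real \<Rightarrow> nat \<Rightarrow> (nat \<Rightarrow> real) \<Rightarrow> bool" where
  "is_periodic_orbit a b q y \<longleftrightarrow> is_orbit a b y \<and> q \<ge> 1 \<and> (\<forall>n. y (n + q) = y n)"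

definition converges_to_cycle :: "(nat \<Rightarrow> real) \<Rightarrow> nat \<Rightarrow> (nat \<Rightarrow> real) \<Rightarrow> bool" where
  "converges_to_cycle x k y \<longleftrightarrow> (\<exists>j. (\<lambda>n. x n - y ((j + n) mod k)) \<longlonglongrightarrow> 0)"

definition universal_limit_cycle :: "real \<Rightarrow> real \<Rightarrow> nat \<Rightarrow> (nat \<Rightarrow> real) \<Rightarrow> bool" where
  "universal_limit_cycle a b k y \<longleftrightarrow>
     is_periodic_orbit a b k y \<and> (\<forall>x. is_orbit a b x \<longrightarrow> converges_to_cycle x k y)"

text \<open>The symbolic sequence is given by its defining formula and is therefore real-valued by
  type; along an orbit its values are integers (lemma \<open>symbolic_seq_in_Ints\<close> below).\<close>

definition symbolic_seq :: "real \<Rightarrow> real \<Rightarrow> (nat \<Rightarrow> real) \<Rightarrow> nat \<Rightarrow> real" where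
  "symbolic_seq a b x i = a * x i + b - x (Suc i)"

definition eventually_periodic :: "(nat \<Rightarrow> 'a) \<Rightarrow> bool" where
  "eventually_periodic s \<longleftrightarrow> (\<exists>N q. q \<ge> 1 \<and> (\<forall>i\<ge>N. s (i + q) = s i))"

definition F_minus :: "real \<Rightarrow> real \<Rightarrow> real \<Rightarrow> real" where
  "F_minus a b x = a * x + b + (1 - a) * of_int \<lfloor>x\<rfloor>"

definition F_plus :: "real \<Rightarrow> real \<Rightarrow> real \<Rightarrow> real" where
  "F_plus a b x = a * x + b - (1 - a) * of_int \<lfloor>1 - x\<rfloor>"

definition is_rotation_number :: "real \<Rightarrow> real \<Rightarrow> real \<Rightarrow> bool" where
  "is_rotation_number a b \<rho> \<longleftrightarrow> \<rho> \<in> {0..<1} \<and>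
     (\<forall>x. (\<lambda>n. (F_minus a b ^^ n) x / real n) \<longlonglongrightarrow> \<rho> \<and>
          (\<lambda>n. (F_plus a b ^^ n) x / real n) \<longlonglongrightarrow> \<rho>)"

lemma is_rotation_number_unique:
  assumes "is_rotation_number a b \<rho>" "is_rotation_number a b \<rho>'"
  shows "\<rho> = \<rho>'"
  using assms unfolding is_rotation_number_def by (blast intro: LIMSEQ_unique)

lemma f_pm_in_unit: "f_pm a b x \<subseteq> {0..1}"
proof -
  have "frac (a * x + b) < 1" "frac (- (a * x + b)) < 1"
    by (rule frac_lt_1)+
  moreover have "0 \<le> frac (a * x + b)" "0 \<le> frac (- (a * x + b))"
    by (rule frac_ge_0)+
  ultimately show ?thesis
    unfolding f_pm_def f_minus_def f_plus_def frac_plus_def by simp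
qed

lemma is_orbit_in_unit: "is_orbit a b x \<Longrightarrow> x n \<in> {0..1}"
  unfolding is_orbit_def by (cases n) (use subsetD[OF f_pm_in_unit] in blast)+

lemma symbolic_seq_in_Ints:
  assumes "is_orbit a b x"
  shows "symbolic_seq a b x i \<in> \<int>"
proof -
  have "x (Suc i) = frac (a * x i + b) \<or> x (Suc i) = 1 - frac (- (a * x i + b))"
    using assms by (auto simp: is_orbit_def f_pm_def f_minus_def f_plus_def frac_plus_def)
  then have "symbolic_seq a b x i = of_int \<lfloor>a * x i + b\<rfloor> \<or>
      symbolic_seq a b x i = of_int (- 1 - \<lfloor>- (a * x i + b)\<rfloor>)"
    by (auto simp: symbolic_seq_def frac_def)
  then show ?thesis by (metis Ints_of_int)
qed

end

theory Submission
  imports Defs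
begin

text \<open>
  Unrolling the circle, an orbit \<open>x\<close> becomes \<open>X n = x n + E n\<close>, where \<open>E n\<close> is the sum of the
  first \<open>n\<close> symbols, and \<open>X (n + 1) = a X n + b + (1 - a) E n\<close> with \<open>E n \<le> X n \<le> E n + 1\<close>. This
  dynamics is strictly order preserving. Comparing \<open>X n\<close> with its translate \<open>X (n + q) - p\<close>, where
  \<open>\<rho> = p / q\<close>, shows that the sign of \<open>X (n + q) - p - X n\<close> is eventually constant; hence
  \<open>E (n + k q) - k p\<close> is eventually monotone in \<open>k\<close>, it is bounded because the rotation number is
  \<open>p / q\<close>, and so it is eventually constant. Thus the symbols are eventually periodic, and by
  contraction the orbit converges to a periodic orbit with these symbols.

  For uniqueness, \<open>\<Sum>n<q. E n\<close> is strictly monotone in the periodic orbit. A time shift adds \<open>p\<close> to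
  it and a translation by \<open>1\<close> adds \<open>q\<close>; as \<open>p\<close> and \<open>q\<close> are coprime, any two periodic orbits can be
  moved to have equal sums, and then they coincide.
\<close>

section \<open>Lifts of orbits to the real line\<close>

text \<open>The label \<open>E\<close> is carried along instead of being computed from
  \<open>X\<close>: when \<open>X n\<close> is an integer, both \<open>X n\<close> and
  \<open>X n - 1\<close> are admissible, and this choice is the one between the two
  branches.\<close>

definition is_lift :: "real \<Rightarrow> real \<Rightarrow> (nat \<Rightarrow> real) \<Rightarrow> (nat \<Rightarrow> int) \<Rightarrow> bool" where
  "is_lift a b X E \<longleftrightarrow> (\<forall>n. of_int (E n) \<le> X n \<and> X n \<le> of_int (E n) + 1 \<and>
     X (Suc n) = a * X n + b + (1 - a) * of_int (E n))"

lemma is_liftD: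
  assumes "is_lift a b X E"
  shows "of_int (E n) \<le> X n" "X n \<le> of_int (E n) + 1"
    "X (Suc n) = a * X n + b + (1 - a) * of_int (E n)"
  using assms unfolding is_lift_def by blast+

lemma is_lift_translate:
  assumes "is_lift a b X E"
  shows "is_lift a b (\<lambda>n. X (n + m) + of_int j) (\<lambda>n. E (n + m) + j)"
  using is_liftD[OF assms, of "_ + m"] unfolding is_lift_def by (auto simp: algebra_simps)

text \<open>The symmetry between the two branches, used to reduce decreasing displacements to
  increasing ones. The new parameter may be negative, so lifts are studied for arbitrary real
  \<open>b\<close>.\<close>

lemma is_lift_reflect:
  assumes "is_lift a b X E"
  shows "is_lift a (1 - a - b) (\<lambda>n. - X n) (\<lambda>n. - E n - 1)"
  using is_liftD[OF assms] unfolding is_lift_def by (auto simp: algebra_simps)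

text \<open>The branch values are exactly the representatives of \<open>a * x n + b\<close> modulo 1
  in the closed unit interval.\<close>

lemma is_orbit_iff:
  "is_orbit a b x \<longleftrightarrow>
     (\<forall>n. 0 \<le> x n \<and> x n \<le> 1) \<and> (\<forall>n. \<exists>e::int. x (Suc n) = a * x n + b - of_int e)"
proof (intro iffI conjI)
  assume *: "is_orbit a b x"
  show "\<forall>n. 0 \<le> x n \<and> x n \<le> 1"
    using is_orbit_in_unit[OF *] by auto
  show "\<forall>n. \<exists>e::int. x (Suc n) = a * x n + b - of_int e"
  proof
    fix n
    obtain e :: int where "symbolic_seq a b x n = of_int e"
      using symbolic_seq_in_Ints[OF *] by (meson Ints_cases)
    then show "\<exists>e::int. x (Suc n) = a * x n + b - of_int e"
      unfolding symbolic_seq_def by (intro exI[of _ e]) linarith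
  qed
next
  assume *: "(\<forall>n. 0 \<le> x n \<and> x n \<le> 1) \<and> (\<forall>n. \<exists>e::int. x (Suc n) = a * x n + b - of_int e)"
  have "x (Suc n) \<in> f_pm a b (x n)" for n
  proof -
    obtain e :: int where e: "x (Suc n) = a * x n + b - of_int e"
      using * by blast
    have bounds: "0 \<le> x (Suc n)" "x (Suc n) \<le> 1"
      using * by blast+
    show ?thesis
    \<comment> \<open>The value 1 is attained only by the plus branch; any other representative is
      the fractional part.\<close>
    proof (cases "x (Suc n) = 1")
      case True
      then have "- (a * x n + b) = of_int (- e - 1)"
        using e by simp
      then have "frac (- (a * x n + b)) = 0"
        by (metis Ints_of_int frac_eq_0_iff)
      then show ?thesis
        using True unfolding f_pm_def f_plus_def frac_plus_def by simp
    next
      case False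
      then have "frac (a * x n + b) = x (Suc n)"
        using e bounds by (intro frac_unique_iff[THEN iffD2]) auto
      then show ?thesis
        unfolding f_pm_def f_minus_def by simp
    qed
  qed
  then show "is_orbit a b x"
    using * unfolding is_orbit_def by auto
qed

lemma orbit_lift:
  assumes "is_orbit a b x"
  obtains E where "is_lift a b (\<lambda>n. x n + of_int (E n)) E"
    and "\<And>n. symbolic_seq a b x n = of_int (E (Suc n) - E n)"
proof -
  obtain e :: "nat \<Rightarrow> int" where e: "\<And>n. x (Suc n) = a * x n + b - of_int (e n)"
    using assms unfolding is_orbit_iff by metis
  define E where "E n = (\<Sum>i<n. e i)" for n
  have "is_lift a b (\<lambda>n. x n + of_int (E n)) E"
    using assms unfolding is_orbit_iff is_lift_def by (auto simp: e E_def algebra_simps)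
  moreover have "symbolic_seq a b x n = of_int (E (Suc n) - E n)" for n
    unfolding symbolic_seq_def by (simp add: e E_def)
  ultimately show ?thesis
    using that by blast
qed

lemma lift_orbit:
  assumes "is_lift a b X E"
  shows "is_orbit a b (\<lambda>n. X n - of_int (E n))"
  unfolding is_orbit_iff
proof (intro conjI allI)
  fix n
  show "\<exists>e::int. X (Suc n) - of_int (E (Suc n)) = a * (X n - of_int (E n)) + b - of_int e"
    using is_liftD(3)[OF assms, of n]
    by (intro exI[of _ "E (Suc n) - E n"]) (simp add: algebra_simps)
qed (use is_liftD[OF assms] in \<open>auto simp: algebra_simps\<close>)

section \<open>Order preservation\<close>

text \<open>The chain \<open>E n \<le> X n < Y n \<le> D n + 1\<close> is between integers.
  Strictness matters: lifts that meet at an integer may carry different labels.\<close>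

lemma is_lift_less_imp_le:
  assumes "is_lift a b X E" "is_lift a b Y D" "X n < Y n"
  shows "E n \<le> D n"
proof -
  have "real_of_int (E n) < of_int (D n + 1)"
    using is_liftD[OF assms(1), of n] is_liftD[OF assms(2), of n] assms(3) by simp
  then show ?thesis
    by (simp only: of_int_less_iff)
qed

lemma is_lift_less_Suc:
  assumes "0 < a" "a < 1" "is_lift a b X E" "is_lift a b Y D" "X n < Y n"
  shows "X (Suc n) < Y (Suc n)"
proof -
  have "(1 - a) * real_of_int (E n) \<le> (1 - a) * of_int (D n)"
    using assms is_lift_less_imp_le[OF assms(3-5)] by (intro mult_left_mono) auto
  moreover have "a * X n < a * Y n"
    using assms by simp
  ultimately show ?thesis
    using is_liftD(3)[OF assms(3), of n] is_liftD(3)[OF assms(4), of n] by simp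
qed

lemma is_lift_less:
  assumes "0 < a" "a < 1" "is_lift a b X E" "is_lift a b Y D" "X n < Y n" "n \<le> m"
  shows "X m < Y m"
  using assms(6)
proof (induction m rule: dec_induct)
  case base
  show ?case by fact
next
  case (step m)
  show ?case
    using is_lift_less_Suc[OF assms(1-4)] step by blast
qed

text \<open>A point alone may leave its label ambiguous; together with the next point it determines
  it through the recursion.\<close>

lemma is_lift_eq:
  assumes "a < 1" "is_lift a b X E" "is_lift a b Y D" "X n = Y n" "X (Suc n) = Y (Suc n)"
  shows "E n = D n"
proof -
  have "(1 - a) * real_of_int (E n) = (1 - a) * of_int (D n)"
    using is_liftD(3)[OF assms(2), of n] is_liftD(3)[OF assms(3), of n] assms by simp
  then show ?thesis
    using assms(1) by simp
qed

section \<open>Rotation number of a lift\<close>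

lemma F_minus_mono: "0 < a \<Longrightarrow> a < 1 \<Longrightarrow> x \<le> y \<Longrightarrow> F_minus a b x \<le> F_minus a b y"
  unfolding F_minus_def
  by (intro add_mono mult_left_mono order.refl) (auto intro: floor_mono)

lemma F_plus_mono: "0 < a \<Longrightarrow> a < 1 \<Longrightarrow> x \<le> y \<Longrightarrow> F_plus a b x \<le> F_plus a b y"
  unfolding F_plus_def
  by (intro add_mono diff_mono mult_left_mono order.refl) (auto intro: floor_mono)

text \<open>\<open>F_plus\<close> and \<open>F_minus\<close> make the smallest and the largest
  choice of label, so they enclose each step of a lift; by monotonicity their iterates enclose the
  whole lift.\<close>

lemma is_lift_rotation_number:
  assumes "0 < a" "a < 1" "is_lift a b X E" "is_rotation_number a b \<rho>"
  shows "(\<lambda>n. X n / real n) \<longlonglongrightarrow> \<rho>"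
proof -
  have step: "F_plus a b (X n) \<le> X (Suc n) \<and> X (Suc n) \<le> F_minus a b (X n)" for n
  proof -
    note X = is_liftD[OF assms(3), of n]
    have "(1 - a) * of_int (E n) \<le> (1 - a) * of_int \<lfloor>X n\<rfloor>"
      using assms X by (intro mult_left_mono) (auto simp: le_floor_iff)
    moreover have "(1 - a) * (- of_int \<lfloor>1 - X n\<rfloor>) \<le> (1 - a) * of_int (E n)"
    proof -
      have "- E n \<le> \<lfloor>1 - X n\<rfloor>"
        using X by (simp add: le_floor_iff)
      then have "- of_int \<lfloor>1 - X n\<rfloor> \<le> real_of_int (E n)"
        by linarith
      then show ?thesis
        using assms by (intro mult_left_mono) auto
    qed
    ultimately show ?thesis
      using X(3) unfolding F_minus_def F_plus_def by (simp add: algebra_simps)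
  qed
  have lower: "(F_plus a b ^^ n) (X 0) \<le> X n" for n
  proof (induction n)
    case (Suc n)
    have "(F_plus a b ^^ Suc n) (X 0) \<le> F_plus a b (X n)"
      using F_plus_mono[OF assms(1,2) Suc] by simp
    then show ?case
      using step[of n] by linarith
  qed simp
  have upper: "X n \<le> (F_minus a b ^^ n) (X 0)" for n
  proof (induction n)
    case (Suc n)
    have "F_minus a b (X n) \<le> (F_minus a b ^^ Suc n) (X 0)"
      using F_minus_mono[OF assms(1,2) Suc] by simp
    then show ?case
      using step[of n] by linarith
  qed simp
  show ?thesis
  proof (rule tendsto_sandwich)
    show "(\<lambda>n. (F_plus a b ^^ n) (X 0) / real n) \<longlonglongrightarrow> \<rho>"
      "(\<lambda>n. (F_minus a b ^^ n) (X 0) / real n) \<longlonglongrightarrow> \<rho>"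
      using assms(4) unfolding is_rotation_number_def by blast+
  qed (intro always_eventually allI divide_right_mono lower upper of_nat_0_le_iff)+
qed

text \<open>By order preservation, a gain of more than \<open>p\<close> in \<open>q\<close> steps
  recurs in every later block of \<open>q\<close> steps.\<close>

lemma is_lift_iterate_less:
  assumes "0 < a" "a < 1" "is_lift a b X E" "X n < X (n + q) - of_int p"
  shows "X (n + k * q) + real j * of_int p \<le> X (n + (k + j) * q)"
proof (induction j)
  case (Suc j)
  have "X (n + (k + j) * q) < X (n + (k + j) * q + q) + of_int (- p)"
    using is_lift_less[OF assms(1-3) is_lift_translate[OF assms(3), of q "- p"],
        of n "n + (k + j) * q"] assms(4) by simp
  with Suc show ?case
    by (simp add: algebra_simps)
qed simp

lemma is_lift_slope_ge:
  assumes "0 < a" "a < 1" "is_lift a b X E" "(\<lambda>n. X n / real n) \<longlonglongrightarrow> \<rho>"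
    and "X n < X (n + q) - of_int p" "q \<ge> 1"
  shows "of_int p / real q \<le> \<rho>"
proof (rule LIMSEQ_le)
  have "strict_mono (\<lambda>j. n + j * q)"
    using assms(6) by (intro strict_monoI) simp
  from LIMSEQ_subseq_LIMSEQ[OF assms(4) this]
  show "(\<lambda>j. X (n + j * q) / real (n + j * q)) \<longlonglongrightarrow> \<rho>"
    by (simp add: o_def)
  \<comment> \<open>Numerator and denominator are divided by \<open>j\<close> to make the limit
    visible; this is valid only for \<open>j > 0\<close>.\<close>
  have "(\<lambda>j. (X n * inverse (real j) + of_int p) / (real n * inverse (real j) + real q))
      \<longlonglongrightarrow> (X n * 0 + of_int p) / (real n * 0 + real q)"
    using assms(6) by (intro tendsto_intros lim_inverse_n) auto
  moreover have "\<forall>\<^sub>F j in sequentially.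
      (X n * inverse (real j) + of_int p) / (real n * inverse (real j) + real q) =
      (X n + real j * of_int p) / real (n + j * q)"
    using eventually_gt_at_top[of 0]
  proof eventually_elim
    case (elim j)
    have "X n + real j * of_int p = (X n * inverse (real j) + of_int p) * real j"
      "real (n + j * q) = (real n * inverse (real j) + real q) * real j"
      using elim by (simp_all add: field_simps)
    then show ?case
      using elim by simp
  qed
  ultimately show "(\<lambda>j. (X n + real j * of_int p) / real (n + j * q)) \<longlonglongrightarrow> of_int p / real q"
    by (simp add: filterlim_cong)
  show "\<exists>N. \<forall>j\<ge>N. (X n + real j * of_int p) / real (n + j * q) \<le>
      X (n + j * q) / real (n + j * q)"
    using is_lift_iterate_less[OF assms(1-3,5), of 0] by (intro exI allI impI divide_right_mono) auto
qed

section \<open>Eventual periodicity of the labels\<close>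

lemma mono_bounded_int_eventually_const:
  fixes f :: "nat \<Rightarrow> int"
  assumes mono: "\<And>k. f k \<le> f (Suc k)" and bound: "\<And>k. f k \<le> B"
  shows "\<exists>K. \<forall>k\<ge>K. f k = f K"
proof -
  have "mono f"
    using mono by (simp add: mono_iff_le_Suc)
  have "range f \<subseteq> {f 0..B}"
    using bound monoD[OF \<open>mono f\<close>, of 0] by auto
  then have "finite (range f)"
    by (rule finite_subset) simp
  then have "Max (range f) \<in> range f"
    by (intro Max_in) auto
  then obtain K where K: "f K = Max (range f)"
    by auto
  have "f k \<le> f K" for k
    unfolding K using \<open>finite (range f)\<close> by simp
  then show ?thesis
    using monoD[OF \<open>mono f\<close>] by (meson order.antisym)
qed

text \<open>There are finitely many residue classes modulo \<open>q\<close>, so their individual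
  thresholds have a maximum.\<close>

lemma residues_eventually:
  assumes "q \<ge> 1" "\<And>r. \<exists>K. \<forall>k\<ge>K. P (N + r + k * q)"
  shows "\<exists>M. \<forall>n\<ge>M. P (n::nat)"
proof -
  obtain K where K: "\<And>r k. k \<ge> K r \<Longrightarrow> P (N + r + k * q)"
    using assms(2) by metis
  define L where "L = Max (K ` {..<q})"
  show ?thesis
  proof (intro exI[of _ "N + (L + 1) * q"] allI impI)
    fix n assume n: "n \<ge> N + (L + 1) * q"
    have "K ((n - N) mod q) \<le> L"
      unfolding L_def using assms(1) by (intro Max_ge) auto
    also have "L \<le> (n - N) div q"
      using n assms(1) by (intro div_le_mono[of "L * q" "n - N" q, simplified, THEN order.trans[rotated]]) auto
    finally have "P (N + (n - N) mod q + (n - N) div q * q)"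
      by (rule K)
    moreover have "N + (n - N) mod q + (n - N) div q * q = n"
      using n by (simp add: add.assoc)
    ultimately show "P n"
      by simp
  qed
qed

lemma is_lift_eventually_periodic_less:
  assumes "0 < a" "a < 1" "is_lift a b X E" "(\<lambda>n. X n / real n) \<longlonglongrightarrow> of_int p / real q"
    and "X N < X (N + q) - of_int p" "q \<ge> 1"
  shows "\<exists>M. \<forall>n\<ge>M. E (n + q) = E n + p"
proof (rule residues_eventually[OF \<open>q \<ge> 1\<close>, of _ N])
  fix r
  have less: "X n < X (n + q) - of_int p" if "N \<le> n" for n
    using is_lift_less[OF assms(1-3) is_lift_translate[OF assms(3), of q "- p"] _ that] assms(5)
    by simp
  define f where "f k = E (N + r + k * q) - int k * p" for k
  \<comment> \<open>An excess above 1 would be a gain of more than \<open>k * p + 1\<close> in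
    \<open>k * q\<close> steps, forcing a rotation number of at least
    \<open>(k * p + 1) / (k * q)\<close>, which exceeds \<open>p / q\<close>.\<close>
  have le: "X (N + r + k * q) \<le> X (N + r) + real k * of_int p + 1" for k
  proof (cases "k = 0")
    case False
    show ?thesis
    proof (rule ccontr)
      assume "\<not> ?thesis"
      then have "X (N + r) < X (N + r + k * q) - of_int (int k * p + 1)"
        by simp
      then have "of_int (int k * p + 1) / real (k * q) \<le> of_int p / real q"
        using False assms(6) by (intro is_lift_slope_ge[OF assms(1-4)]) auto
      then show False
        using False assms(6) by (simp add: field_simps)
    qed
  qed simp
  have "\<exists>K. \<forall>k\<ge>K. f k = f K"
  proof (rule mono_bounded_int_eventually_const)
    fix k
    have "X (N + r + k * q) < X (N + r + k * q + q) + of_int (- p)"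
      using less[of "N + r + k * q"] by simp
    from is_lift_less_imp_le[OF assms(3) is_lift_translate[OF assms(3), of q "- p"] this]
    show "f k \<le> f (Suc k)"
      unfolding f_def by (simp add: algebra_simps)
    have "real_of_int (f k) \<le> X (N + r) + 1"
      unfolding f_def using le[of k] is_liftD(1)[OF assms(3), of "N + r + k * q"] by simp
    then show "f k \<le> \<lfloor>X (N + r) + 1\<rfloor>"
      unfolding le_floor_iff .
  qed
  then obtain K where K: "\<And>k. k \<ge> K \<Longrightarrow> f k = f K"
    by blast
  show "\<exists>K. \<forall>k\<ge>K. E (N + r + k * q + q) = E (N + r + k * q) + p"
  proof (intro exI[of _ K] allI impI)
    fix k assume "k \<ge> K"
    then have "f (Suc k) = f k"
      using K[of k] K[of "Suc k"] by simp
    then show "E (N + r + k * q + q) = E (N + r + k * q) + p"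
      unfolding f_def by (simp add: algebra_simps)
  qed
qed

text \<open>A positive displacement at one time is the previous lemma, a negative one is its
  reflection. If the displacement always vanishes, consecutive points determine the labels.\<close>

lemma is_lift_eventually_periodic:
  assumes "0 < a" "a < 1" "is_lift a b X E" "(\<lambda>n. X n / real n) \<longlonglongrightarrow> of_int p / real q" "q \<ge> 1"
  shows "\<exists>M. \<forall>n\<ge>M. E (n + q) = E n + p"
proof -
  consider N where "X N < X (N + q) - of_int p" | N where "- X N < - X (N + q) - of_int (- p)"
    | "\<And>n. X n = X (n + q) - of_int p"
  proof (cases "\<exists>N. X N \<noteq> X (N + q) - of_int p")
    case True
    then obtain N where "X N < X (N + q) - of_int p \<or> - X N < - X (N + q) - of_int (- p)"
      by (force simp: less_le)
    then show ?thesis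
      using that(1,2) by blast
  qed (use that(3) in blast)
  then show ?thesis
  proof cases
    case 1
    then show ?thesis
      using is_lift_eventually_periodic_less[OF assms(1-4)] assms(5) by blast
  next
    case 2
    have "(\<lambda>n. - X n / real n) \<longlonglongrightarrow> of_int (- p) / real q"
      using tendsto_minus[OF assms(4)] by simp
    from is_lift_eventually_periodic_less[OF assms(1,2) is_lift_reflect[OF assms(3)] this 2 assms(5)]
    obtain M where M: "\<And>n. n \<ge> M \<Longrightarrow> - E (n + q) - 1 = - E n - 1 + - p"
      by blast
    have "E (n + q) = E n + p" if "n \<ge> M" for n
      using M[OF that] by simp
    then show ?thesis
      by blast
  next
    case 3
    have "E n = E (n + q) + - p" for n
      using is_lift_eq[OF assms(2,3) is_lift_translate[OF assms(3), of q "- p"], of n]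
        3[of n] 3[of "Suc n"] by simp
    then show ?thesis
      by (auto simp: algebra_simps)
  qed
qed

section \<open>Convergence to a periodic lift\<close>

lemma geometric_tendsto_0:
  fixes u :: "nat \<Rightarrow> real"
  assumes "0 < a" "a < 1" "\<And>n. n \<ge> M \<Longrightarrow> u (Suc n) = a * u n"
  shows "u \<longlonglongrightarrow> 0"
proof -
  have "u (n + M) = a ^ n * u M" for n
    by (induction n) (auto simp: assms(3))
  moreover have "(\<lambda>n. a ^ n * u M) \<longlonglongrightarrow> 0 * u M"
    using assms by (intro tendsto_intros LIMSEQ_power_zero) auto
  ultimately have "(\<lambda>n. u (n + M)) \<longlonglongrightarrow> 0"
    by simp
  then show ?thesis
    by (rule LIMSEQ_offset)
qed

definition is_periodic_lift ::
    "real \<Rightarrow> real \<Rightarrow> nat \<Rightarrow> int \<Rightarrow> (nat \<Rightarrow> real) \<Rightarrow> (nat \<Rightarrow> int) \<Rightarrow> bool" where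
  "is_periodic_lift a b q p X E \<longleftrightarrow> is_lift a b X E \<and>
     (\<forall>n. X (n + q) = X n + of_int p) \<and> (\<forall>n. E (n + q) = E n + p)"

lemma periodic_add_mult:
  fixes f :: "nat \<Rightarrow> 'a"
  assumes "\<And>n. f (n + q) = f n"
  shows "f (n + k * q) = f n"
  using assms[of "n + _ * q"] by (induction k) (simp_all add: algebra_simps)

text \<open>Once the labels are fixed, the recursion is an affine contraction whose solutions differ
  by multiples of \<open>a ^ n\<close>; one of them is periodic.\<close>

lemma is_lift_tendsto_periodic:
  assumes "0 < a" "a < 1" "is_lift a b X E" "\<And>n. n \<ge> M \<Longrightarrow> E (n + q) = E n + p" "q \<ge> 1"
  obtains Y D where "is_periodic_lift a b q p Y D"
    and "(\<lambda>n. (X n - of_int (E n)) - (Y n - of_int (D n))) \<longlonglongrightarrow> 0"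
proof -
  \<comment> \<open>A multiple of \<open>q\<close> beyond \<open>M\<close>: shifting by
    \<open>m\<close> and subtracting \<open>M * p\<close> leaves the labels from time
    \<open>M\<close> on unchanged.\<close>
  define m where "m = M * q"
  have "m \<ge> M"
    using assms(5) unfolding m_def by simp
  \<comment> \<open>\<open>c\<close> is chosen such that adding \<open>c a^n\<close> to the shifted \<open>X\<close> makes it exactly periodic.\<close>
  define d where "d = X (m + q) - of_int p - X m"
  define c where "c = d / (1 - a ^ q)"
  define Y where "Y n = X (n + m) - real M * of_int p + c * a ^ n" for n
  define D where "D n = E (n + m) - int M * p" for n
  have rec: "Y (Suc n) = a * Y n + b + (1 - a) * of_int (D n)" for n
    unfolding Y_def D_def using is_liftD(3)[OF assms(3), of "n + m"] by (simp add: algebra_simps)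
  have Dq: "D (n + q) = D n + p" for n
    using assms(4)[of "n + m"] \<open>m \<ge> M\<close> unfolding D_def by (simp add: add_ac)
  have d: "X (n + m + q) - of_int p - X (n + m) = d * a ^ n" for n
  proof (induction n)
    case (Suc n)
    have "E (n + m + q) = E (n + m) + p"
      using assms(4)[of "n + m"] \<open>m \<ge> M\<close> by simp
    then have "X (Suc n + m + q) - of_int p - X (Suc n + m) =
        a * (X (n + m + q) - of_int p - X (n + m))"
      using is_liftD(3)[OF assms(3), of "n + m"] is_liftD(3)[OF assms(3), of "n + m + q"]
      by (simp add: algebra_simps)
    then show ?case
      using Suc by simp
  qed (simp add: d_def)
  have "a ^ q < 1"
    using assms by (simp add: power_less_one_iff)
  have Yq: "Y (n + q) = Y n + of_int p" for n
  proof -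
    have "Y (n + q) - Y n - of_int p = d * a ^ n - c * (1 - a ^ q) * a ^ n"
      unfolding Y_def d[symmetric] by (simp add: algebra_simps power_add)
    also have "c * (1 - a ^ q) = d"
      unfolding c_def using \<open>a ^ q < 1\<close> by simp
    finally show ?thesis
      by simp
  qed
  have DE: "D n = E n" if "n \<ge> M" for n
  proof -
    have "E (n + k * q) = E n + int k * p" for k
      using that assms(4)[of "n + _ * q"] by (induction k) (simp_all add: algebra_simps)
    then show ?thesis
      unfolding D_def m_def by simp
  qed
  have "X (Suc n) - Y (Suc n) = a * (X n - Y n)" if "n \<ge> M" for n
    unfolding rec is_liftD(3)[OF assms(3), of n] DE[OF that] by (simp add: algebra_simps)
  then have "(\<lambda>n. X n - Y n) \<longlonglongrightarrow> 0"
    by (rule geometric_tendsto_0[OF assms(1,2)])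
  then have lim: "(\<lambda>n. (X n - of_int (E n)) - (Y n - of_int (D n))) \<longlonglongrightarrow> 0"
    by (rule Lim_transform_eventually)
      (use DE in \<open>auto simp: eventually_sequentially intro!: exI[of _ M]\<close>)
  \<comment> \<open>Adding \<open>c * a ^ n\<close> could violate the bounds, but by periodicity
    each value of \<open>g\<close> is a limit of positions of the original lift, and the unit
    interval is closed.\<close>
  have bounds: "0 \<le> Y n - of_int (D n) \<and> Y n - of_int (D n) \<le> 1" for n
  proof -
    define g where "g n = Y n - of_int (D n)" for n
    have "g (n + k * q) = g n" for k
      by (rule periodic_add_mult) (simp add: g_def Yq Dq)
    moreover have "strict_mono (\<lambda>k. n + k * q)"
      using assms(5) by (intro strict_monoI) simp
    from LIMSEQ_subseq_LIMSEQ[OF lim this]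
    have "(\<lambda>k. (X (n + k * q) - of_int (E (n + k * q))) - g (n + k * q)) \<longlonglongrightarrow> 0"
      by (simp add: o_def g_def)
    ultimately have "(\<lambda>k. (X (n + k * q) - of_int (E (n + k * q))) - g n + g n) \<longlonglongrightarrow> 0 + g n"
      by (intro tendsto_intros) simp
    then have lim': "(\<lambda>k. X (n + k * q) - of_int (E (n + k * q))) \<longlonglongrightarrow> g n"
      by simp
    have "0 \<le> X i - of_int (E i)" "X i - of_int (E i) \<le> 1" for i
      using is_liftD(1,2)[OF assms(3), of i] by linarith+
    then have "0 \<le> g n" "g n \<le> 1"
      using LIMSEQ_le_const[OF lim'] LIMSEQ_le_const2[OF lim'] by blast+
    then show ?thesis
      unfolding g_def by blast
  qed
  have "is_lift a b Y D"
    unfolding is_lift_def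
  proof (intro allI conjI)
    fix n
    show "of_int (D n) \<le> Y n" "Y n \<le> of_int (D n) + 1"
      using bounds[of n] by linarith+
  qed (rule rec)
  then have "is_periodic_lift a b q p Y D"
    using Yq Dq unfolding is_periodic_lift_def by blast
  then show ?thesis
    using lim that by blast
qed

section \<open>Uniqueness of periodic lifts\<close>

lemma is_periodic_lift_translate:
  assumes "is_periodic_lift a b q p X E"
  shows "is_periodic_lift a b q p (\<lambda>n. X (n + m) + of_int j) (\<lambda>n. E (n + m) + j)"
proof -
  have "X (n + q + m) = X (n + m) + of_int p" "E (n + q + m) = E (n + m) + p" for n
    using assms unfolding is_periodic_lift_def by (metis add.assoc add.commute)+
  then show ?thesis
    using assms is_lift_translate[of a b X E m j] unfolding is_periodic_lift_def by simp
qed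

text \<open>Moving the window by one step trades \<open>E m\<close> for \<open>E (m + q)\<close>, a
  gain of \<open>p\<close>.\<close>

lemma sum_periodic_shift:
  fixes E :: "nat \<Rightarrow> int"
  assumes "\<And>n. E (n + q) = E n + p"
  shows "(\<Sum>n<q. E (n + m)) = (\<Sum>n<q. E n) + int m * p"
proof (induction m)
  case (Suc m)
  have "(\<Sum>n<q. E (n + Suc m)) = (\<Sum>n<Suc q. E (n + m)) - E m"
    unfolding sum.lessThan_Suc_shift by simp
  also have "\<dots> = (\<Sum>n<q. E (n + m)) + p"
    using assms[of m] by (simp add: add.commute)
  finally show ?case
    using Suc by (simp add: algebra_simps)
qed simp

text \<open>Ordered lifts have ordered labels, so equal sums force equal labels over a period. The
  gap then shrinks by the factor \<open>a ^ q\<close>, although periodicity preserves it.\<close>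

lemma is_periodic_lift_not_less:
  assumes "0 < a" "a < 1" "q \<ge> 1" "is_periodic_lift a b q p X E" "is_periodic_lift a b q p Y D"
    and "(\<Sum>n<q. E n) = (\<Sum>n<q. D n)"
  shows "\<not> X 0 < Y 0"
proof
  assume "X 0 < Y 0"
  have lifts: "is_lift a b X E" "is_lift a b Y D"
    using assms unfolding is_periodic_lift_def by blast+
  have "E n \<le> D n" for n
    using is_lift_less_imp_le[OF lifts] is_lift_less[OF assms(1,2) lifts \<open>X 0 < Y 0\<close>] by blast
  then have eq: "E n = D n" if "n < q" for n
    using assms(6) that sum_mono_inv[of E "{..<q}" D n] by auto
  have "n \<le> q \<Longrightarrow> Y n - X n = a ^ n * (Y 0 - X 0)" for n
  proof (induction n)
    case (Suc n)
    then have "Y (Suc n) - X (Suc n) = a * (Y n - X n)"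
      using is_liftD(3)[OF lifts(1), of n] is_liftD(3)[OF lifts(2), of n] eq[of n]
      by (simp add: algebra_simps)
    then show ?case
      using Suc by simp
  qed simp
  from this[of q] have "Y 0 - X 0 = a ^ q * (Y 0 - X 0)"
    using assms(4,5) unfolding is_periodic_lift_def by (metis add_0 add_diff_cancel_right order.refl)
  then have "a ^ q = 1"
    using \<open>X 0 < Y 0\<close> by simp
  moreover have "a ^ q < 1"
    using assms by (simp add: power_less_one_iff)
  ultimately show False
    by simp
qed

lemma is_periodic_lift_unique:
  assumes "0 < a" "a < 1" "q \<ge> 1" "is_periodic_lift a b q p X E" "is_periodic_lift a b q p Y D"
    and sums: "(\<Sum>n<q. E n) = (\<Sum>n<q. D n)"
  shows "X = Y" "E = D"
proof -
  have XY: "X m = Y m" for m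
  proof -
    \<comment> \<open>Equality of sums survives a common time shift, so the comparison at time 0
      applies at every time \<open>m\<close>.\<close>
    have "(\<Sum>n<q. E (n + m)) = (\<Sum>n<q. D (n + m))"
      using assms(4,5) sums sum_periodic_shift[of E q p m] sum_periodic_shift[of D q p m]
      unfolding is_periodic_lift_def by simp
    then show ?thesis
      using is_periodic_lift_not_less[OF assms(1-3)
          is_periodic_lift_translate[OF assms(4), of m 0]
          is_periodic_lift_translate[OF assms(5), of m 0]]
        is_periodic_lift_not_less[OF assms(1-3)
          is_periodic_lift_translate[OF assms(5), of m 0]
          is_periodic_lift_translate[OF assms(4), of m 0]] by simp
  qed
  then show "X = Y"
    by blast
  show "E = D"
    using is_lift_eq[OF assms(2)] assms(4,5) XY unfolding is_periodic_lift_def by blast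
qed

lemma coprime_int_combination:
  fixes p t :: int
  assumes "coprime p (int q)" "q \<ge> 1"
  obtains i :: nat and j :: int where "int i * p + j * int q = t"
proof -
  obtain u v where uv: "u * p + v * int q = 1"
    using bezout_int[of p "int q"] assms(1) by auto
  \<comment> \<open>A time shift must be nonnegative, so the Bezout coefficient is reduced modulo
    \<open>q\<close>; the quotient is absorbed into \<open>j\<close>.\<close>
  define i where "i = nat ((u * t) mod int q)"
  have i: "int i = u * t - (u * t) div int q * int q"
    using assms(2) unfolding i_def by (simp add: minus_div_mult_eq_mod)
  have "t = (u * p + v * int q) * t"
    unfolding uv by simp
  also have "\<dots> = int i * p + (v * t + (u * t) div int q * p) * int q"
    unfolding i by (simp add: algebra_simps)
  finally show ?thesis
    using that by metis
qed

text \<open>The integer translation that equalizes the sums cancels in the positions; only a change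
  of phase \<open>i\<close> remains.\<close>

lemma is_periodic_lift_conjugate:
  assumes "0 < a" "a < 1" "q \<ge> 1" "coprime p (int q)"
    and "is_periodic_lift a b q p X E" "is_periodic_lift a b q p Y D"
  obtains i where "\<And>n. X n - of_int (E n) = Y (n + i) - of_int (D (n + i))"
proof -
  obtain i :: nat and j :: int
    where ij: "int i * p + j * int q = (\<Sum>n<q. E n) - (\<Sum>n<q. D n)"
    using coprime_int_combination[OF assms(4,3)] by blast
  have "(\<Sum>n<q. D (n + i) + j) = (\<Sum>n<q. D n) + int i * p + j * int q"
    using assms(6) sum_periodic_shift[of D q p i] unfolding is_periodic_lift_def
    by (simp add: sum.distrib)
  then have sums: "(\<Sum>n<q. E n) = (\<Sum>n<q. D (n + i) + j)"
    using ij by simp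
  have "X = (\<lambda>n. Y (n + i) + of_int j)" "E = (\<lambda>n. D (n + i) + j)"
    using is_periodic_lift_unique[OF assms(1-3,5) is_periodic_lift_translate[OF assms(6)] sums]
    by blast+
  then show ?thesis
    by (intro that[of i]) simp
qed

section \<open>Existence of the universal limit cycle\<close>

lemma orbit_exists: "\<exists>x. is_orbit a b x"
proof (intro exI)
  show "is_orbit a b (\<lambda>n. (f_minus a b ^^ n) 0)"
    unfolding is_orbit_def f_pm_def by simp
qed

theorem theorem8p4:
  fixes a b \<rho> :: real
  assumes "0 < a" and "a < 1" and "0 \<le> b" and "b < 1"
    and "is_rotation_number a b \<rho>" and "\<rho> \<in> \<rat>"
  shows "(\<exists>k y. universal_limit_cycle a b k y \<and>
            (\<forall>x. is_orbit a b x \<longrightarrow> converges_to_cycle x k y)) \<and>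
         (\<forall>x. is_orbit a b x \<longrightarrow> eventually_periodic (symbolic_seq a b x))"
proof -
  have "\<rho> \<ge> 0"
    using assms(5) unfolding is_rotation_number_def by simp
  \<comment> \<open>Lowest terms are essential for matching the sums; for rotation number 0 they
    give \<open>q = 1\<close>.\<close>
  obtain m q :: nat where "q \<noteq> 0" "\<bar>\<rho>\<bar> = real m / real q" "coprime m q"
    using Rats_abs_nat_div_natE[OF assms(6)] by blast
  define p where "p = int m"
  have q: "q \<ge> 1" and \<rho>: "\<rho> = of_int p / real q" and "coprime p (int q)"
    using \<open>q \<noteq> 0\<close> \<open>\<bar>\<rho>\<bar> = _\<close> \<open>coprime m q\<close> \<open>\<rho> \<ge> 0\<close> unfolding p_def by auto
  have lift: "\<exists>E M. is_lift a b (\<lambda>n. x n + of_int (E n)) E \<and>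
      (\<forall>n\<ge>M. E (n + q) = E n + p) \<and>
      (\<forall>n. symbolic_seq a b x n = of_int (E (Suc n) - E n))" if x: "is_orbit a b x" for x
  proof -
    obtain E where E: "is_lift a b (\<lambda>n. x n + of_int (E n)) E"
      "\<And>n. symbolic_seq a b x n = of_int (E (Suc n) - E n)"
      using orbit_lift[OF x] by blast
    have "\<exists>M. \<forall>n\<ge>M. E (n + q) = E n + p"
      using is_lift_eventually_periodic[OF assms(1,2) E(1)]
        is_lift_rotation_number[OF assms(1,2) E(1) assms(5)] q unfolding \<rho> by blast
    with E show ?thesis
      by blast
  qed
  have limit: "\<exists>Y D. is_periodic_lift a b q p Y D \<and>
      (\<lambda>n. x n - (Y n - of_int (D n))) \<longlonglongrightarrow> 0" if x: "is_orbit a b x" for x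
  proof -
    obtain E M where E: "is_lift a b (\<lambda>n. x n + of_int (E n)) E"
      "\<And>n. n \<ge> M \<Longrightarrow> E (n + q) = E n + p"
      using lift[OF x] by blast
    obtain Y D where "is_periodic_lift a b q p Y D"
      "(\<lambda>n. (x n + of_int (E n) - of_int (E n)) - (Y n - of_int (D n))) \<longlonglongrightarrow> 0"
      using is_lift_tendsto_periodic[OF assms(1,2) E q] by blast
    then show ?thesis
      by auto
  qed
  \<comment> \<open>The candidate cycle is the limit of an arbitrary orbit.\<close>
  obtain Y D where Y: "is_periodic_lift a b q p Y D"
    using limit orbit_exists by blast
  define y where "y n = Y n - of_int (D n)" for n
  have y_periodic: "y (n + q) = y n" for n
    using Y unfolding is_periodic_lift_def y_def by simp
  have "is_orbit a b y"
    using Y lift_orbit[of a b Y D] unfolding is_periodic_lift_def y_def by blast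
  then have periodic: "is_periodic_orbit a b q y"
    unfolding is_periodic_orbit_def using q y_periodic by blast
  have y_mod: "y (n mod q) = y n" for n
    using periodic_add_mult[of y q "n mod q" "n div q"] y_periodic by simp
  have conv: "converges_to_cycle x q y" if x: "is_orbit a b x" for x
  proof -
    obtain Z C where Z: "is_periodic_lift a b q p Z C"
      "(\<lambda>n. x n - (Z n - of_int (C n))) \<longlonglongrightarrow> 0"
      using limit[OF x] by blast
    obtain i where "\<And>n. Z n - of_int (C n) = y (n + i)"
      using is_periodic_lift_conjugate[OF assms(1,2) q \<open>coprime p (int q)\<close> Z(1) Y]
      unfolding y_def by blast
    with Z(2) have "(\<lambda>n. x n - y ((i + n) mod q)) \<longlonglongrightarrow> 0"
      by (simp add: y_mod add.commute)
    then show ?thesis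
      unfolding converges_to_cycle_def by blast
  qed
  have symb: "eventually_periodic (symbolic_seq a b x)" if x: "is_orbit a b x" for x
  proof -
    obtain E M where E: "\<And>n. n \<ge> M \<Longrightarrow> E (n + q) = E n + p"
      "\<And>n. symbolic_seq a b x n = of_int (E (Suc n) - E n)"
      using lift[OF x] by blast
    have "symbolic_seq a b x (n + q) = symbolic_seq a b x n" if "n \<ge> M" for n
      using E(1)[of n] E(1)[of "Suc n"] that by (simp add: E(2))
    then show ?thesis
      unfolding eventually_periodic_def using q by blast
  qed
  show ?thesis
    unfolding universal_limit_cycle_def using periodic conv symb by blast
qed

end
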